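(* Let $S$ be a near $e$ subsemigroup of a semitopological semigroup $(T,+)$, where $e$ has a countable local base in $T$. Let $l\in\mathbb{N}$ and let $I^\Diamond\subseteq S^l$ be a near $\overline{e}$ subsemigroup of $T^l$ such that for each $i\in\{1,\dots,l\}$, $\pi_i[I^\Diamond]\subseteq S$ is piecewise syndetic near $e$, and for each $\mathcal{E}_i\subseteq\pi_i[I^\Diamond]$, if $e\in cl_T(\mathcal{E}_i)$ then $\overline{e}\in cl_{T^l}(\pi_i^{-1}(\mathcal{E}_i))$, where $\pi_i:I^\Diamond\to\pi_i[I^\Diamond]$ is the projection onto the $i$-th coordinate. Let $B\subseteq S$. (1) If $B\subseteq S$ is $central^*$ near $e$, then $B^l\cap I^\Diamond\subseteq I^\Diamond$ is $central^*$ near $\overline{e}$. (2) If $B\subseteq S$ is $PS^*$ near $e$, then $B^l\cap I^\Diamond\subseteq I^\Diamond$ is $PS^*$ near $\overline{e}$.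
   Context: A semitopological semigroup $(T,+)$ is a semigroup (additive notation) with a Hausdorff topology in which all translations are continuous; $\tau_x$ are the neighborhoods of $x$. $T^l$ has the product topology and coordinatewise operation; $\overline{e}=(e,\dots,e)$. A subsemigroup $S$ of $T$ with $e$ an idempotent of $T$ not in $S$ is a near $e$ subsemigroup if $e\in cl_T(S)$. $\beta S$ is the set of ultrafilters on $S$ with $p+q=\{X:\{s:-s+X\in q\}\in p\}$, $-s+X=\{t:s+t\in X\}$; $e_S^*=\{p\in\beta S: U\cap S\in p\ \forall U\in\tau_e\}$ with smallest ideal $K(e_S^* )$. $A\subseteq S$ is central near $e$ if $A\in p$ for some idempotent $p\in K(e_S^* )$, and $central^*$ near $e$ if it meets every central set near $e$. With a decreasing countable local base $\langle W_n\rangle$ at $e$, $A\subseteq S$ is piecewise syndetic near $e$ if there are finite nonempty $F_n\subseteq W_n\cap S$ and $V_n\in\tau_e$, $V_n\subseteq W_n$, such that for every finite nonempty $G\subseteq S$ and $O\in\tau_e$ there is $x\in O\cap S$ with $(G\cap V_n)+x\subseteq\bigcup_{t\in F_n}(-t+A)$ for all $n$ (independent of the base); $A$ is $PS^*$ near $e$ if it meets every piecewise syndetic set near $e$. The same notions apply to $I^\Diamond$ as a near $\overline e$ subsemigroup of $T^l$. *)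

theory Defs
  imports "HOL-Analysis.Analysis"
begin

section \<open>Semitopological semigroups\<close>

text \<open>The semigroup is not assumed commutative, and addition need not be jointly continuous.\<close>

class semitopological_semigroup_add = t2_space + semigroup_add +
  assumes tendsto_left_translation: "filterlim (\<lambda>x. a + x) (nhds (a + b)) (nhds b)"
    and tendsto_right_translation: "filterlim (\<lambda>x. x + a) (nhds (b + a)) (nhds b)"

lemma continuous_on_translation:
  fixes a :: "'a::semitopological_semigroup_add"
  shows "continuous_on UNIV (\<lambda>x. a + x)" "continuous_on UNIV (\<lambda>x. x + a)"
proof -
  have le: "at x \<le> nhds x" for x :: 'a
    by (simp add: at_within_def)
  show "continuous_on UNIV (\<lambda>x. a + x)" "continuous_on UNIV (\<lambda>x. x + a)"
    unfolding continuous_on_def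
    using tendsto_mono[OF le tendsto_left_translation]
      tendsto_mono[OF le tendsto_right_translation] by blast+
qed

instance vec :: (t0_space, finite) t0_space
proof
  fix x y :: "'a ^ 'b"
  assume "x \<noteq> y"
  then obtain i where "x $ i \<noteq> y $ i"
    by (auto simp: vec_eq_iff)
  then obtain U where "open U" "x $ i \<in> U \<longleftrightarrow> y $ i \<notin> U"
    using separation_t0[of "x $ i" "y $ i"] by blast
  then show "\<exists>U. open U \<and> \<not> (x \<in> U \<longleftrightarrow> y \<in> U)"
    by (auto simp: open_vimage_vec_nth intro!: exI[of _ "(\<lambda>v. v $ i) -` U"])
qed

instance vec :: (t1_space, finite) t1_space
proof
  fix x y :: "'a ^ 'b"
  assume "x \<noteq> y"
  then obtain i where "x $ i \<noteq> y $ i"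
    by (auto simp: vec_eq_iff)
  then obtain U where "open U" "x $ i \<in> U" "y $ i \<notin> U"
    using t1_space[of "x $ i" "y $ i"] by blast
  then show "\<exists>U. open U \<and> x \<in> U \<and> y \<notin> U"
    by (auto simp: open_vimage_vec_nth intro!: exI[of _ "(\<lambda>v. v $ i) -` U"])
qed

instance vec :: (t2_space, finite) t2_space
proof
  fix x y :: "'a ^ 'b"
  assume "x \<noteq> y"
  then obtain i where "x $ i \<noteq> y $ i"
    by (auto simp: vec_eq_iff)
  then obtain U V where UV: "open U" "open V" "x $ i \<in> U" "y $ i \<in> V" "U \<inter> V = {}"
    using hausdorff[of "x $ i" "y $ i"] by blast
  let ?U = "(\<lambda>v::'a ^ 'b. v $ i) -` U" and ?V = "(\<lambda>v::'a ^ 'b. v $ i) -` V"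
  have "open ?U" "open ?V" "x \<in> ?U" "y \<in> ?V" "?U \<inter> ?V = {}"
    using UV by (auto simp: open_vimage_vec_nth)
  then show "\<exists>U V. open U \<and> open V \<and> x \<in> U \<and> y \<in> V \<and> U \<inter> V = {}"
    by blast
qed

text \<open>
  For a finite index type \<open>'n\<close> with \<open>l\<close> elements, \<open>T ^ 'n\<close> is the power of \<open>T\<close> to
  the \<open>l\<close>, with coordinatewise addition and the product topology.
\<close>

instance vec :: (semitopological_semigroup_add, finite) semitopological_semigroup_add
proof
  fix a b :: "'a ^ 'b"
  have nth: "((\<lambda>x. x $ i) \<longlongrightarrow> b $ i) (nhds b)" for i
    by (intro tendsto_vec_nth filterlim_ident)
  show "((\<lambda>x. a + x) \<longlongrightarrow> a + b) (nhds b)"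
    unfolding plus_vec_def
    by (intro tendsto_vec_lambda filterlim_compose[OF tendsto_left_translation nth])
  show "((\<lambda>x. x + a) \<longlongrightarrow> b + a) (nhds b)"
    unfolding plus_vec_def
    by (intro tendsto_vec_lambda filterlim_compose[OF tendsto_right_translation nth])
qed

definition neighborhoods :: "'a::topological_space \<Rightarrow> 'a set set" where
  "neighborhoods x = {U. \<exists>O'. open O' \<and> x \<in> O' \<and> O' \<subseteq> U}"

definition local_base :: "'a::topological_space \<Rightarrow> 'a set set \<Rightarrow> bool" where
  "local_base x \<B> \<longleftrightarrow> \<B> \<subseteq> neighborhoods x \<and> (\<forall>U\<in>neighborhoods x. \<exists>W\<in>\<B>. W \<subseteq> U)"

definition decreasing_local_base :: "'a::topological_space \<Rightarrow> (nat \<Rightarrow> 'a set) \<Rightarrow> bool" where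
  "decreasing_local_base x W \<longleftrightarrow> local_base x (range W) \<and> decseq W"

definition near_subsemigroup :: "'a::semitopological_semigroup_add set \<Rightarrow> 'a \<Rightarrow> bool" where
  "near_subsemigroup S e \<longleftrightarrow>
     (\<forall>s\<in>S. \<forall>t\<in>S. s + t \<in> S) \<and> e + e = e \<and> e \<notin> S \<and> e \<in> closure S"


section \<open>Ultrafilters on a semigroup\<close>

text \<open>An ultrafilter on \<open>S\<close> is represented by the set of its members, all of them subsets of \<open>S\<close>.\<close>

definition ultrafilters :: "'a set \<Rightarrow> 'a set set set" where
  "ultrafilters S = {p. p \<subseteq> Pow S \<and> S \<in> p \<and> {} \<notin> p \<and>
     (\<forall>X\<in>p. \<forall>Y\<in>p. X \<inter> Y \<in> p) \<and>
     (\<forall>X\<in>p. \<forall>Y. X \<subseteq> Y \<and> Y \<subseteq> S \<longrightarrow> Y \<in> p) \<and>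
     (\<forall>X. X \<subseteq> S \<longrightarrow> X \<in> p \<or> S - X \<in> p)}"

definition translate_preimage :: "'a::plus set \<Rightarrow> 'a \<Rightarrow> 'a set \<Rightarrow> 'a set" where
  "translate_preimage S s X = {t\<in>S. s + t \<in> X}"

definition uf_plus :: "'a::plus set \<Rightarrow> 'a set set \<Rightarrow> 'a set set \<Rightarrow> 'a set set" where
  "uf_plus S p q = {X. X \<subseteq> S \<and> {s\<in>S. translate_preimage S s X \<in> q} \<in> p}"

definition e_star :: "'a::topological_space set \<Rightarrow> 'a \<Rightarrow> 'a set set set" where
  "e_star S e = {p\<in>ultrafilters S. \<forall>U\<in>neighborhoods e. U \<inter> S \<in> p}"

definition is_ideal :: "('b \<Rightarrow> 'b \<Rightarrow> 'b) \<Rightarrow> 'b set \<Rightarrow> 'b set \<Rightarrow> bool" where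
  "is_ideal f M J \<longleftrightarrow> J \<noteq> {} \<and> J \<subseteq> M \<and> (\<forall>m\<in>M. \<forall>j\<in>J. f m j \<in> J \<and> f j m \<in> J)"

definition smallest_ideal :: "('b \<Rightarrow> 'b \<Rightarrow> 'b) \<Rightarrow> 'b set \<Rightarrow> 'b set" where
  "smallest_ideal f M = \<Inter>{J. is_ideal f M J}"

lemma smallest_ideal_eqI:
  assumes "is_ideal f M K" and "\<And>J. is_ideal f M J \<Longrightarrow> K \<subseteq> J"
  shows "smallest_ideal f M = K"
  unfolding smallest_ideal_def using assms by blast


section \<open>Largeness near an idempotent\<close>

definition central_near :: "'a::semitopological_semigroup_add set \<Rightarrow> 'a \<Rightarrow> 'a set \<Rightarrow> bool" where
  "central_near S e A \<longleftrightarrow> A \<subseteq> S \<and>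
     (\<exists>p\<in>smallest_ideal (uf_plus S) (e_star S e). uf_plus S p p = p \<and> A \<in> p)"

definition central_star_near :: "'a::semitopological_semigroup_add set \<Rightarrow> 'a \<Rightarrow> 'a set \<Rightarrow> bool" where
  "central_star_near S e A \<longleftrightarrow> A \<subseteq> S \<and> (\<forall>C. central_near S e C \<longrightarrow> A \<inter> C \<noteq> {})"

definition piecewise_syndetic_wrt ::
  "(nat \<Rightarrow> 'a set) \<Rightarrow> 'a::semitopological_semigroup_add set \<Rightarrow> 'a \<Rightarrow> 'a set \<Rightarrow> bool" where
  "piecewise_syndetic_wrt W S e A \<longleftrightarrow> A \<subseteq> S \<and>
     (\<exists>F V. (\<forall>n. finite (F n) \<and> F n \<noteq> {} \<and> F n \<subseteq> W n \<inter> S) \<and>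
            (\<forall>n. V n \<in> neighborhoods e \<and> V n \<subseteq> W n) \<and>
            (\<forall>G O'. finite G \<and> G \<noteq> {} \<and> G \<subseteq> S \<and> O' \<in> neighborhoods e \<longrightarrow>
               (\<exists>x\<in>O' \<inter> S. \<forall>n.
                  (\<lambda>g. g + x) ` (G \<inter> V n) \<subseteq> (\<Union>t\<in>F n. translate_preimage S t A))))"

definition piecewise_syndetic_near ::
  "'a::semitopological_semigroup_add set \<Rightarrow> 'a \<Rightarrow> 'a set \<Rightarrow> bool" where
  "piecewise_syndetic_near S e A \<longleftrightarrow>
     (\<exists>W. decreasing_local_base e W \<and> piecewise_syndetic_wrt W S e A)"

text \<open>The choice of the decreasing local base is immaterial.\<close>

lemma piecewise_syndetic_wrt_mono:
  assumes W: "decreasing_local_base e W" and W': "decreasing_local_base e W'"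
    and A: "piecewise_syndetic_wrt W S e A"
  shows "piecewise_syndetic_wrt W' S e A"
proof -
  have "\<exists>k. W k \<subseteq> W' n" for n
    using W W' unfolding decreasing_local_base_def local_base_def by blast
  then obtain k where k: "\<And>n. W (k n) \<subseteq> W' n"
    by metis
  obtain F V where F: "\<forall>n. finite (F n) \<and> F n \<noteq> {} \<and> F n \<subseteq> W n \<inter> S"
    and V: "\<forall>n. V n \<in> neighborhoods e \<and> V n \<subseteq> W n"
    and ex: "\<forall>G O'. finite G \<and> G \<noteq> {} \<and> G \<subseteq> S \<and> O' \<in> neighborhoods e \<longrightarrow>
      (\<exists>x\<in>O' \<inter> S. \<forall>n. (\<lambda>g. g + x) ` (G \<inter> V n) \<subseteq> (\<Union>t\<in>F n. translate_preimage S t A))"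
    and "A \<subseteq> S"
    using A unfolding piecewise_syndetic_wrt_def
    by (elim conjE exE) (rule that; assumption)
  have "\<forall>n. finite (F (k n)) \<and> F (k n) \<noteq> {} \<and> F (k n) \<subseteq> W' n \<inter> S"
    using F k by blast
  moreover have "\<forall>n. V (k n) \<in> neighborhoods e \<and> V (k n) \<subseteq> W' n"
    using V k by blast
  moreover have "\<forall>G O'. finite G \<and> G \<noteq> {} \<and> G \<subseteq> S \<and> O' \<in> neighborhoods e \<longrightarrow>
      (\<exists>x\<in>O' \<inter> S. \<forall>n. (\<lambda>g. g + x) ` (G \<inter> V (k n))
        \<subseteq> (\<Union>t\<in>F (k n). translate_preimage S t A))"
  proof (intro allI impI)
    fix G O'
    assume "finite G \<and> G \<noteq> {} \<and> G \<subseteq> S \<and> O' \<in> neighborhoods e"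
    from ex[rule_format, OF this] obtain x where "x \<in> O' \<inter> S" and
      x: "\<forall>n. (\<lambda>g. g + x) ` (G \<inter> V n) \<subseteq> (\<Union>t\<in>F n. translate_preimage S t A)"
      by (rule bexE)
    show "\<exists>x\<in>O' \<inter> S. \<forall>n. (\<lambda>g. g + x) ` (G \<inter> V (k n))
        \<subseteq> (\<Union>t\<in>F (k n). translate_preimage S t A)"
      by (rule bexI[OF _ \<open>x \<in> O' \<inter> S\<close>]) (rule allI, rule x[rule_format])
  qed
  ultimately show ?thesis
    unfolding piecewise_syndetic_wrt_def
    by (intro conjI \<open>A \<subseteq> S\<close> exI[of _ "\<lambda>n. F (k n)"] exI[of _ "\<lambda>n. V (k n)"])
qed

lemma piecewise_syndetic_near_iff:
  assumes "decreasing_local_base e W"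
  shows "piecewise_syndetic_near S e A \<longleftrightarrow> piecewise_syndetic_wrt W S e A"
  using assms piecewise_syndetic_wrt_mono unfolding piecewise_syndetic_near_def by blast

definition PS_star_near :: "'a::semitopological_semigroup_add set \<Rightarrow> 'a \<Rightarrow> 'a set \<Rightarrow> bool" where
  "PS_star_near S e A \<longleftrightarrow>
     A \<subseteq> S \<and> (\<forall>C. piecewise_syndetic_near S e C \<longrightarrow> A \<inter> C \<noteq> {})"

end

theory Submission
  imports Defs
begin

text \<open>
  Let \<open>M\<close> be the compact right topological semigroup of ultrafilters on \<open>S\<close> converging to \<open>e\<close>.
  A compactness argument gives a minimal left ideal, hence \<open>p \<in> K(M)\<close> iff every \<open>q \<in> M\<close> admits
  some \<open>u \<in> M\<close> with \<open>u + q + p = p\<close>; moreover the piecewise syndetic sets near \<open>e\<close> are exactly the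
  members of elements of \<open>K(M)\<close>. The projection \<open>\<pi>\<^sub>i\<close> induces a homomorphism \<open>\<phi>\<close> from the semigroup
  for \<open>I\<close> to the one for \<open>S\<close>. As \<open>\<pi>\<^sub>i[I]\<close> is piecewise syndetic, it lies in some \<open>k \<in> K(M)\<close>, and
  the closure hypothesis lifts \<open>k\<close> to some \<open>k'\<close> with \<open>\<phi> k' = k\<close>. If \<open>r\<close> is in the smallest ideal
  for \<open>I\<close>, then \<open>r = u + k' + r\<close> for some \<open>u\<close>, so \<open>\<phi> r = \<phi> u + k + \<phi> r \<in> K(M)\<close>. Consequently \<open>B\<close>,
  which lies in all (idempotent) elements of \<open>K(M)\<close>, belongs to \<open>\<phi> r\<close> for each \<open>i\<close>, that is,
  \<open>B\<^sup>l \<inter> I \<in> r\<close>.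
\<close>

section \<open>Ultrafilters\<close>

lemma ultrafilters_top: "p \<in> ultrafilters S \<Longrightarrow> S \<in> p"
  and ultrafilters_empty: "p \<in> ultrafilters S \<Longrightarrow> {} \<notin> p"
  and ultrafilters_subset: "p \<in> ultrafilters S \<Longrightarrow> X \<in> p \<Longrightarrow> X \<subseteq> S"
  and ultrafilters_Int: "p \<in> ultrafilters S \<Longrightarrow> X \<in> p \<Longrightarrow> Y \<in> p \<Longrightarrow> X \<inter> Y \<in> p"
  and ultrafilters_mono: "p \<in> ultrafilters S \<Longrightarrow> X \<in> p \<Longrightarrow> X \<subseteq> Y \<Longrightarrow> Y \<subseteq> S \<Longrightarrow> Y \<in> p"
  unfolding ultrafilters_def by blast+

lemma ultrafilters_Diff_iff:
  assumes p: "p \<in> ultrafilters S" and "X \<subseteq> S"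
  shows "S - X \<in> p \<longleftrightarrow> X \<notin> p"
proof -
  have "X \<in> p \<or> S - X \<in> p"
    using assms unfolding ultrafilters_def by blast
  moreover have "\<not> (X \<in> p \<and> S - X \<in> p)"
  proof
    assume "X \<in> p \<and> S - X \<in> p"
    then have "X \<inter> (S - X) \<in> p" using ultrafilters_Int[OF p] by blast
    moreover have "X \<inter> (S - X) = {}" by blast
    ultimately show False using ultrafilters_empty[OF p] by simp
  qed
  ultimately show ?thesis by blast
qed

text \<open>Ultrafilters are maximal filters. The extension arguments below yield only an inclusion
  between two ultrafilters, and this upgrades it to an equality.\<close>

lemma ultrafilters_subset_eq:
  assumes p: "p \<in> ultrafilters S" and q: "q \<in> ultrafilters S" and "p \<subseteq> q"
  shows "p = q"
proof (rule equalityI[OF \<open>p \<subseteq> q\<close>], rule subsetI)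
  fix X assume "X \<in> q"
  then have X: "X \<subseteq> S" by (rule ultrafilters_subset[OF q])
  then have "S - X \<notin> p"
    using ultrafilters_Diff_iff[OF q X] \<open>X \<in> q\<close> \<open>p \<subseteq> q\<close> by blast
  then show "X \<in> p"
    using ultrafilters_Diff_iff[OF p X] by blast
qed

lemma ultrafilters_INT:
  assumes p: "p \<in> ultrafilters S" and "finite F" and "\<And>s. s \<in> F \<Longrightarrow> X s \<in> p"
  shows "S \<inter> (\<Inter>s\<in>F. X s) \<in> p"
  using assms(2,3)
proof (induction F rule: finite_induct)
  case empty
  then show ?case using ultrafilters_top[OF p] by simp
next
  case (insert a F)
  then have "X a \<inter> (S \<inter> (\<Inter>s\<in>F. X s)) \<in> p"
    by (intro ultrafilters_Int[OF p] insert.IH) auto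
  then show ?case by (simp add: Int_left_commute)
qed

lemma ultrafilters_UN:
  assumes p: "p \<in> ultrafilters S" and "finite F" and "(\<Union>s\<in>F. X s) \<in> p"
  shows "\<exists>s\<in>F. X s \<in> p"
proof (rule ccontr)
  have sub: "X s \<subseteq> S" if "s \<in> F" for s
    using ultrafilters_subset[OF p assms(3)] that by blast
  assume "\<not> (\<exists>s\<in>F. X s \<in> p)"
  then have "S - X s \<in> p" if "s \<in> F" for s
    using ultrafilters_Diff_iff[OF p sub] that by blast
  then have "S \<inter> (\<Inter>s\<in>F. S - X s) \<in> p"
    by (rule ultrafilters_INT[OF p \<open>finite F\<close>])
  then have "(S \<inter> (\<Inter>s\<in>F. S - X s)) \<inter> (\<Union>s\<in>F. X s) \<in> p"
    using assms(3) by (rule ultrafilters_Int[OF p])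
  moreover have "(S \<inter> (\<Inter>s\<in>F. S - X s)) \<inter> (\<Union>s\<in>F. X s) = {}" by blast
  ultimately show False using ultrafilters_empty[OF p] by simp
qed

text \<open>Zorn's lemma gives a maximal family with the finite intersection property. The factor
  \<open>S\<close> matters for the empty subfamily, whose \<open>\<Inter>\<close> is
  \<open>UNIV\<close>: it forces \<open>S\<close> to be nonempty.\<close>

lemma ultrafilter_extension:
  assumes "\<A> \<subseteq> Pow S"
    and "\<And>\<B>. finite \<B> \<Longrightarrow> \<B> \<subseteq> \<A> \<Longrightarrow> S \<inter> \<Inter>\<B> \<noteq> {}"
  obtains p where "p \<in> ultrafilters S" "\<A> \<subseteq> p"
proof -
  define P where "P = {\<F>. \<A> \<subseteq> \<F> \<and> \<F> \<subseteq> Pow S \<and> (\<forall>\<B>. finite \<B> \<longrightarrow> \<B> \<subseteq> \<F> \<longrightarrow> S \<inter> \<Inter>\<B> \<noteq> {})}"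
  have PD: "\<A> \<subseteq> \<F>" "\<F> \<subseteq> Pow S" "\<And>\<B>. finite \<B> \<Longrightarrow> \<B> \<subseteq> \<F> \<Longrightarrow> S \<inter> \<Inter>\<B> \<noteq> {}"
    if "\<F> \<in> P" for \<F>
    using that unfolding P_def by simp_all
  have PI: "\<F> \<in> P"
    if "\<A> \<subseteq> \<F>" "\<F> \<subseteq> Pow S" "\<And>\<B>. finite \<B> \<Longrightarrow> \<B> \<subseteq> \<F> \<Longrightarrow> S \<inter> \<Inter>\<B> \<noteq> {}" for \<F>
    using that unfolding P_def by simp
  have "\<A> \<in> P" by (rule PI[OF order_refl assms])
  have "\<exists>p\<in>P. \<forall>\<F>\<in>P. p \<subseteq> \<F> \<longrightarrow> \<F> = p"
  proof (rule subset_Zorn_nonempty)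
    show "P \<noteq> {}" using \<open>\<A> \<in> P\<close> by blast
    fix \<C> assume "\<C> \<noteq> {}" and chain: "subset.chain P \<C>"
    then have sub: "\<C> \<subseteq> P" by (simp add: subset.chain_def)
    have "S \<inter> \<Inter>\<B> \<noteq> {}" if \<B>: "finite \<B>" "\<B> \<subseteq> \<Union>\<C>" for \<B>
    proof -
      obtain \<F> where "\<F> \<in> \<C>" "\<B> \<subseteq> \<F>"
        using finite_subset_Union_chain[OF \<B> \<open>\<C> \<noteq> {}\<close> chain] .
      then show ?thesis using PD(3)[of \<F> \<B>] sub \<open>finite \<B>\<close> by blast
    qed
    moreover obtain \<F> where "\<F> \<in> \<C>" using \<open>\<C> \<noteq> {}\<close> by blast
    then have "\<A> \<subseteq> \<Union>\<C>" using PD(1)[of \<F>] sub by blast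
    moreover have "\<Union>\<C> \<subseteq> Pow S" by (rule Union_least) (use PD(2) sub in blast)
    ultimately show "\<Union>\<C> \<in> P" by (intro PI)
  qed
  then obtain p where "p \<in> P" and max: "\<And>\<F>. \<F> \<in> P \<Longrightarrow> p \<subseteq> \<F> \<Longrightarrow> \<F> = p" by blast
  note p = PD[OF \<open>p \<in> P\<close>]
  \<comment> \<open>Adding such an \<open>X\<close> keeps the finite intersection property, so
    maximality puts it into \<open>p\<close>. Closure under intersections and supersets and the
    choice between \<open>X\<close> and \<open>S - X\<close> rest on this step and on
    \<open>filt\<close>.\<close>
  have ext: "X \<in> p" if "X \<subseteq> S" and X: "\<And>\<B>. finite \<B> \<Longrightarrow> \<B> \<subseteq> p \<Longrightarrow> S \<inter> \<Inter>\<B> \<inter> X \<noteq> {}" for X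
  proof -
    have "S \<inter> \<Inter>\<B> \<noteq> {}" if "finite \<B>" "\<B> \<subseteq> insert X p" for \<B>
    proof -
      have "S \<inter> \<Inter>(\<B> - {X}) \<inter> X \<noteq> {}"
        using that by (intro X) auto
      then show ?thesis by blast
    qed
    then have "insert X p \<in> P" using p(1,2) \<open>X \<subseteq> S\<close> by (intro PI) auto
    then show ?thesis using max[of "insert X p"] by blast
  qed
  have filt: "X \<in> p" if "X \<subseteq> S" "finite \<D>" "\<D> \<subseteq> p" "S \<inter> \<Inter>\<D> \<subseteq> X" for X \<D>
  proof (rule ext[OF \<open>X \<subseteq> S\<close>])
    fix \<B> assume "finite \<B>" "\<B> \<subseteq> p"
    then have "S \<inter> \<Inter>(\<B> \<union> \<D>) \<noteq> {}" using that by (intro p(3)) auto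
    then show "S \<inter> \<Inter>\<B> \<inter> X \<noteq> {}" using that(4) by blast
  qed
  have "S \<in> p" by (rule filt[of S "{}"]) auto
  moreover have "{} \<notin> p" using p(3)[of "{{}}"] by auto
  moreover have "X \<inter> Y \<in> p" if "X \<in> p" "Y \<in> p" for X Y
    by (rule filt[of _ "{X, Y}"]) (use that p(2) in auto)
  moreover have "Y \<in> p" if "X \<in> p" "X \<subseteq> Y" "Y \<subseteq> S" for X Y
    by (rule filt[of _ "{X}"]) (use that p(2) in auto)
  moreover have "X \<in> p \<or> S - X \<in> p" if "X \<subseteq> S" for X
  proof (rule disjCI)
    assume "S - X \<notin> p"
    show "X \<in> p"
    proof (rule ext[OF that])
      fix \<B> assume "finite \<B>" "\<B> \<subseteq> p"
      then have "\<not> S \<inter> \<Inter>\<B> \<subseteq> S - X"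
        using filt[of "S - X" \<B>] \<open>S - X \<notin> p\<close> by auto
      then show "S \<inter> \<Inter>\<B> \<inter> X \<noteq> {}" by auto
    qed
  qed
  ultimately have "p \<in> ultrafilters S" using p(2) unfolding ultrafilters_def by simp
  then show thesis using that p(1) by blast
qed

section \<open>Ultrafilters converging to a point, and their compactness\<close>

lemma neighborhoods_UNIV: "UNIV \<in> neighborhoods x"
  unfolding neighborhoods_def by blast

lemma neighborhoods_Int:
  assumes "U \<in> neighborhoods x" "V \<in> neighborhoods x"
  shows "U \<inter> V \<in> neighborhoods x"
proof -
  obtain A B where "open A" "x \<in> A" "A \<subseteq> U" "open B" "x \<in> B" "B \<subseteq> V"
    using assms unfolding neighborhoods_def by blast
  then have "open (A \<inter> B) \<and> x \<in> A \<inter> B \<and> A \<inter> B \<subseteq> U \<inter> V" by blast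
  then show ?thesis
    unfolding neighborhoods_def by blast
qed

lemma closure_iff_neighborhoods: "x \<in> closure X \<longleftrightarrow> (\<forall>U\<in>neighborhoods x. U \<inter> X \<noteq> {})"
  unfolding closure_iff_nhds_not_empty neighborhoods_def by blast

lemma eventually_nhds_neighborhoods: "eventually P (nhds x) \<longleftrightarrow> {y. P y} \<in> neighborhoods x"
  unfolding eventually_nhds neighborhoods_def by blast

lemma filterlim_nhds_neighborhoods:
  assumes "filterlim f (nhds y) (nhds x)" "U \<in> neighborhoods y"
  shows "f -` U \<in> neighborhoods x"
proof -
  have "eventually (\<lambda>z. z \<in> U) (nhds y)"
    using assms(2) by (simp add: eventually_nhds_neighborhoods)
  then have "eventually (\<lambda>z. f z \<in> U) (nhds x)"
    using assms(1) unfolding filterlim_iff by blast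
  then show ?thesis by (simp add: eventually_nhds_neighborhoods vimage_def)
qed

lemma e_star_ultrafilter: "p \<in> e_star S e \<Longrightarrow> p \<in> ultrafilters S"
  and e_star_neighborhood: "p \<in> e_star S e \<Longrightarrow> U \<in> neighborhoods e \<Longrightarrow> U \<inter> S \<in> p"
  unfolding e_star_def by blast+

text \<open>Together with \<open>e_star_extension_single\<close> this identifies the sets that
  belong to some element of \<open>e_star S e\<close>: the subsets of \<open>S\<close> with
  \<open>e\<close> in their closure.\<close>

lemma e_star_closure:
  assumes p: "p \<in> e_star S e" and "X \<in> p"
  shows "e \<in> closure X"
  unfolding closure_iff_neighborhoods
proof
  fix U assume "U \<in> neighborhoods e"
  then have "U \<inter> S \<inter> X \<in> p"
    using p \<open>X \<in> p\<close> by (blast intro: ultrafilters_Int e_star_ultrafilter e_star_neighborhood)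
  then have "U \<inter> S \<inter> X \<noteq> {}"
    using ultrafilters_empty[OF e_star_ultrafilter[OF p]] by metis
  then show "U \<inter> X \<noteq> {}" by blast
qed

text \<open>Compactness of \<open>e_star S e\<close> in the form used throughout. Directedness
  bounds any finite choice from \<open>\<A>\<close> and the neighborhood traces below by a single
  \<open>Z \<inter> U\<close>, which is nonempty because \<open>e \<in> closure Z\<close>.\<close>

lemma e_star_extension:
  assumes "\<A> \<noteq> {}" and "\<A> \<subseteq> Pow S" and cl: "\<And>X. X \<in> \<A> \<Longrightarrow> e \<in> closure X"
    and dir: "\<And>X Y. X \<in> \<A> \<Longrightarrow> Y \<in> \<A> \<Longrightarrow> \<exists>Z\<in>\<A>. Z \<subseteq> X \<inter> Y"
  obtains p where "p \<in> e_star S e" "\<A> \<subseteq> p"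
proof -
  define \<N> where "\<N> = (\<lambda>U. U \<inter> S) ` neighborhoods e"
  have lower: "\<exists>Z\<in>\<A>. \<exists>U\<in>neighborhoods e. Z \<inter> U \<subseteq> S \<inter> \<Inter>\<B>" if "finite \<B>" "\<B> \<subseteq> \<A> \<union> \<N>" for \<B>
    using that
  proof (induction \<B> rule: finite_induct)
    case empty
    obtain Z where "Z \<in> \<A>" using assms(1) by blast
    then show ?case using assms(2) neighborhoods_UNIV
      by (intro bexI[of _ Z] bexI[of _ UNIV]) auto
  next
    case (insert X \<B>)
    then obtain Z U where ZU: "Z \<in> \<A>" "U \<in> neighborhoods e" "Z \<inter> U \<subseteq> S \<inter> \<Inter>\<B>" by blast
    from insert.prems consider "X \<in> \<A>" | "X \<in> \<N>" by blast
    then show ?case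
    proof cases
      case 1
      then obtain Y where "Y \<in> \<A>" "Y \<subseteq> X \<inter> Z" using dir ZU(1) by blast
      then show ?thesis using ZU by (intro bexI[of _ Y] bexI[of _ U]) auto
    next
      case 2
      then obtain V where "V \<in> neighborhoods e" "X = V \<inter> S" unfolding \<N>_def by blast
      then show ?thesis using ZU
        by (intro bexI[of _ Z] bexI[of _ "U \<inter> V"] neighborhoods_Int) auto
    qed
  qed
  have "\<A> \<union> \<N> \<subseteq> Pow S" using assms(2) unfolding \<N>_def by blast
  moreover have "S \<inter> \<Inter>\<B> \<noteq> {}" if \<B>: "finite \<B>" "\<B> \<subseteq> \<A> \<union> \<N>" for \<B>
  proof -
    obtain Z U where ZU: "Z \<in> \<A>" "U \<in> neighborhoods e" "Z \<inter> U \<subseteq> S \<inter> \<Inter>\<B>"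
      using lower[OF \<B>] by blast
    then have "U \<inter> Z \<noteq> {}" using cl unfolding closure_iff_neighborhoods by blast
    then show ?thesis using ZU(3) by blast
  qed
  ultimately obtain p where p: "p \<in> ultrafilters S" "\<A> \<union> \<N> \<subseteq> p"
    by (rule ultrafilter_extension)
  have "U \<inter> S \<in> p" if "U \<in> neighborhoods e" for U
    using p(2) that unfolding \<N>_def by blast
  then have "p \<in> e_star S e" using p(1) unfolding e_star_def by blast
  moreover have "\<A> \<subseteq> p" using p(2) by blast
  ultimately show thesis by (rule that)
qed

lemma e_star_extension_single:
  assumes "X \<subseteq> S" "e \<in> closure X"
  obtains p where "p \<in> e_star S e" "X \<in> p"
proof -
  have "{X} \<noteq> {}" "{X} \<subseteq> Pow S" using assms(1) by simp_all
  moreover have "e \<in> closure Y" if "Y \<in> {X}" for Y using assms(2) that by simp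
  moreover have "\<exists>Z\<in>{X}. Z \<subseteq> Y \<inter> Y'" if "Y \<in> {X}" "Y' \<in> {X}" for Y Y' using that by simp
  ultimately obtain p where "p \<in> e_star S e" "{X} \<subseteq> p"
    by (rule e_star_extension)
  then show thesis by (intro that) simp_all
qed

text \<open>Compactness in covering form. If it failed, the complements of the finite unions would
  be a directed family with \<open>e\<close> in all closures, and an element of
  \<open>e_star S e\<close> extending it would contain no \<open>X s\<close> with
  \<open>s \<in> J\<close>.\<close>

lemma e_star_finite_cover:
  assumes cover: "\<And>p. p \<in> e_star S e \<Longrightarrow> \<exists>s\<in>J. X s \<in> p"
  shows "\<exists>F V. finite F \<and> F \<subseteq> J \<and> V \<in> neighborhoods e \<and> V \<inter> S \<subseteq> (\<Union>s\<in>F. X s)"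
proof (rule ccontr)
  assume contra: "\<not> ?thesis"
  define \<A> where "\<A> = (\<lambda>F. S - (\<Union>s\<in>F. X s)) ` {F. finite F \<and> F \<subseteq> J}"
  have "\<A> \<noteq> {}" "\<A> \<subseteq> Pow S" unfolding \<A>_def by auto
  moreover have "e \<in> closure Y" if Y: "Y \<in> \<A>" for Y
    unfolding closure_iff_neighborhoods
  proof
    fix U assume "U \<in> neighborhoods e"
    obtain F where F: "finite F" "F \<subseteq> J" "Y = S - (\<Union>s\<in>F. X s)" using Y unfolding \<A>_def by blast
    then have "\<not> U \<inter> S \<subseteq> (\<Union>s\<in>F. X s)" using contra \<open>U \<in> neighborhoods e\<close> by blast
    then show "U \<inter> Y \<noteq> {}" using F(3) by blast
  qed
  moreover have "\<exists>Z\<in>\<A>. Z \<subseteq> Y \<inter> Y'" if Y: "Y \<in> \<A>" "Y' \<in> \<A>" for Y Y'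
  proof -
    obtain F F' where F: "finite F" "F \<subseteq> J" "Y = S - (\<Union>s\<in>F. X s)"
      "finite F'" "F' \<subseteq> J" "Y' = S - (\<Union>s\<in>F'. X s)"
      using Y unfolding \<A>_def by blast
    then have "S - (\<Union>s\<in>F \<union> F'. X s) \<in> \<A>" unfolding \<A>_def by (intro imageI) simp
    moreover have "S - (\<Union>s\<in>F \<union> F'. X s) \<subseteq> Y \<inter> Y'" using F by blast
    ultimately show ?thesis by blast
  qed
  ultimately obtain p where p: "p \<in> e_star S e" "\<A> \<subseteq> p"
    by (rule e_star_extension)
  then obtain s where s: "s \<in> J" "X s \<in> p" using cover by blast
  then have "S - X s \<in> \<A>" unfolding \<A>_def by (intro image_eqI[of _ _ "{s}"]) auto
  then have "S - X s \<in> p" using p(2) by blast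
  then show False
    using s(2) ultrafilters_Diff_iff ultrafilters_subset e_star_ultrafilter[OF p(1)] by metis
qed

section \<open>The smallest ideal\<close>

text \<open>Purely algebraic. The condition on \<open>p\<close> says that \<open>p\<close> can be
  recovered from each of its left multiples, so that it generates a minimal left ideal. Such
  elements form an ideal as soon as one exists, and \<open>l\<close> is that one.\<close>

lemma smallest_ideal_characterization:
  assumes closed: "\<And>x y. x \<in> M \<Longrightarrow> y \<in> M \<Longrightarrow> f x y \<in> M"
    and assoc: "\<And>x y z. x \<in> M \<Longrightarrow> y \<in> M \<Longrightarrow> z \<in> M \<Longrightarrow> f (f x y) z = f x (f y z)"
    and l: "l \<in> M" "\<And>q. q \<in> M \<Longrightarrow> \<exists>u\<in>M. f u (f q l) = l"
  shows "is_ideal f M (smallest_ideal f M)"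
    and "p \<in> smallest_ideal f M \<longleftrightarrow> p \<in> M \<and> (\<forall>q\<in>M. \<exists>u\<in>M. f u (f q p) = p)"
proof -
  define K where "K = {p\<in>M. \<forall>q\<in>M. \<exists>u\<in>M. f u (f q p) = p}"
  have left: "f m p \<in> K" if "m \<in> M" "p \<in> K" for m p
  proof -
    have "p \<in> M" using that unfolding K_def by blast
    have "\<exists>u\<in>M. f u (f q (f m p)) = f m p" if "q \<in> M" for q
    proof -
      obtain u where "u \<in> M" "f u (f (f q m) p) = p"
        using \<open>p \<in> K\<close> closed[OF \<open>q \<in> M\<close> \<open>m \<in> M\<close>] unfolding K_def by blast
      then show ?thesis
        using \<open>p \<in> M\<close> \<open>m \<in> M\<close> \<open>q \<in> M\<close>
        \<comment> \<open>Multiplying \<open>f u (f (f q m) p) = p\<close> by \<open>m\<close> on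
          the left recovers \<open>f m p\<close> from \<open>f q (f m p)\<close>.\<close>
        by (intro bexI[of _ "f m u"]) (simp_all add: assoc closed)
    qed
    then show ?thesis using \<open>p \<in> M\<close> \<open>m \<in> M\<close> closed unfolding K_def by blast
  qed
  have right: "f p m \<in> K" if "m \<in> M" "p \<in> K" for m p
  proof -
    have "p \<in> M" using that unfolding K_def by blast
    have "\<exists>u\<in>M. f u (f q (f p m)) = f p m" if "q \<in> M" for q
    proof -
      obtain u where "u \<in> M" "f u (f q p) = p"
        using \<open>p \<in> K\<close> \<open>q \<in> M\<close> unfolding K_def by blast
      then show ?thesis
        using \<open>p \<in> M\<close> \<open>m \<in> M\<close> \<open>q \<in> M\<close> by (metis assoc closed)
    qed
    then show ?thesis using \<open>p \<in> M\<close> \<open>m \<in> M\<close> closed unfolding K_def by blast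
  qed
  have "l \<in> K" using l unfolding K_def by blast
  moreover have "K \<subseteq> M" unfolding K_def by blast
  ultimately have K: "is_ideal f M K"
    unfolding is_ideal_def using left right by blast
  have "smallest_ideal f M = K"
  proof (rule smallest_ideal_eqI[OF K], rule subsetI)
    fix J p assume J: "is_ideal f M J" and "p \<in> K"
    then obtain j where j: "j \<in> J" "j \<in> M" unfolding is_ideal_def by blast
    \<comment> \<open>Recovering \<open>p\<close> from its multiple by some \<open>j \<in> J\<close>
      writes \<open>p\<close> as a product with a factor in \<open>J\<close>.\<close>
    then obtain u where u: "u \<in> M" "f u (f j p) = p" using \<open>p \<in> K\<close> unfolding K_def by blast
    have "p \<in> M" using \<open>p \<in> K\<close> unfolding K_def by blast
    then have "f u (f j p) \<in> J" using J j(1) u(1) unfolding is_ideal_def by blast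
    then show "p \<in> J" using u(2) by simp
  qed
  then show "is_ideal f M (smallest_ideal f M)"
    and "p \<in> smallest_ideal f M \<longleftrightarrow> p \<in> M \<and> (\<forall>q\<in>M. \<exists>u\<in>M. f u (f q p) = p)"
    using K unfolding K_def by auto
qed

section \<open>The semigroup of ultrafilters converging to an idempotent\<close>

lemma uf_plus_iff:
  "X \<in> uf_plus S p q \<longleftrightarrow> X \<subseteq> S \<and> {s\<in>S. translate_preimage S s X \<in> q} \<in> p"
  unfolding uf_plus_def by simp

lemma translate_preimage_subset: "translate_preimage S s X \<subseteq> S"
  unfolding translate_preimage_def by blast

lemma translate_preimage_mono: "X \<subseteq> Y \<Longrightarrow> translate_preimage S s X \<subseteq> translate_preimage S s Y"
  unfolding translate_preimage_def by blast

locale near_idempotent =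
  fixes S :: "'a::semitopological_semigroup_add set" and e :: 'a
  assumes near: "near_subsemigroup S e"
begin

lemma add_closed: "s \<in> S \<Longrightarrow> t \<in> S \<Longrightarrow> s + t \<in> S"
  and idem: "e + e = e"
  and not_mem: "e \<notin> S"
  and in_closure: "e \<in> closure S"
  using near unfolding near_subsemigroup_def by blast+

abbreviation M where "M \<equiv> e_star S e"
abbreviation K where "K \<equiv> smallest_ideal (uf_plus S) (e_star S e)"

lemma translate_preimage_Diff:
  "s \<in> S \<Longrightarrow> translate_preimage S s (S - X) = S - translate_preimage S s X"
  unfolding translate_preimage_def using add_closed by blast

text \<open>Translation preimages and membership in \<open>q\<close> both respect intersections and
  complements. The sets \<open>D X\<close> therefore do as well, and the ultrafilter properties are
  inherited from \<open>p\<close>.\<close>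

lemma uf_plus_ultrafilter:
  assumes p: "p \<in> ultrafilters S" and q: "q \<in> ultrafilters S"
  shows "uf_plus S p q \<in> ultrafilters S"
proof -
  define D where "D X = {s\<in>S. translate_preimage S s X \<in> q}" for X
  have iff: "X \<in> uf_plus S p q \<longleftrightarrow> X \<subseteq> S \<and> D X \<in> p" for X
    unfolding D_def by (rule uf_plus_iff)
  have D_sub: "D X \<subseteq> S" for X unfolding D_def by blast
  have "translate_preimage S s S = S" if "s \<in> S" for s
    using that add_closed unfolding translate_preimage_def by blast
  then have "D S = S"
    using ultrafilters_top[OF q] unfolding D_def by auto
  then have top: "D S \<in> p" using ultrafilters_top[OF p] by simp
  have "D {} = {}"
    using ultrafilters_empty[OF q] unfolding D_def translate_preimage_def by auto
  then have empty: "D {} \<notin> p" using ultrafilters_empty[OF p] by simp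
  have mono: "D Y \<in> p" if "D X \<in> p" "X \<subseteq> Y" for X Y
  proof -
    have "D X \<subseteq> D Y"
      unfolding D_def
      using ultrafilters_mono[OF q _ translate_preimage_mono[OF \<open>X \<subseteq> Y\<close>] translate_preimage_subset]
      by blast
    then show ?thesis using ultrafilters_mono[OF p \<open>D X \<in> p\<close> _ D_sub] by blast
  qed
  have int: "D (X \<inter> Y) \<in> p" if "D X \<in> p" "D Y \<in> p" for X Y
  proof -
    have "translate_preimage S s (X \<inter> Y) = translate_preimage S s X \<inter> translate_preimage S s Y" for s
      unfolding translate_preimage_def by blast
    then have "D X \<inter> D Y \<subseteq> D (X \<inter> Y)" unfolding D_def using ultrafilters_Int[OF q] by auto
    then show ?thesis using ultrafilters_mono[OF p ultrafilters_Int[OF p that] _ D_sub] by blast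
  qed
  have "D (S - X) = S - D X" for X
    unfolding D_def
    using translate_preimage_Diff ultrafilters_Diff_iff[OF q translate_preimage_subset] by auto
  then have compl: "D X \<in> p \<or> D (S - X) \<in> p" for X
    using ultrafilters_Diff_iff[OF p D_sub] by auto
  show ?thesis
    unfolding ultrafilters_def mem_Collect_eq
  proof (intro conjI ballI allI impI)
    show "uf_plus S p q \<subseteq> Pow S" "S \<in> uf_plus S p q" "{} \<notin> uf_plus S p q"
      using iff top empty by blast+
    show "X \<inter> Y \<in> uf_plus S p q" if "X \<in> uf_plus S p q" "Y \<in> uf_plus S p q" for X Y
      using that int unfolding iff by blast
    show "Y \<in> uf_plus S p q" if "X \<in> uf_plus S p q" "X \<subseteq> Y \<and> Y \<subseteq> S" for X Y
      using that mono unfolding iff by blast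
    show "X \<in> uf_plus S p q \<or> S - X \<in> uf_plus S p q" if "X \<subseteq> S" for X
      using that compl unfolding iff by blast
  qed
qed

text \<open>Both sides unfold to the same nested condition on
  \<open>translate_preimage S (a + b) X\<close>.\<close>

lemma uf_plus_assoc:
  "uf_plus S (uf_plus S p q) r = uf_plus S p (uf_plus S q r)"
proof -
  have *: "translate_preimage S b (translate_preimage S a X) = translate_preimage S (a + b) X"
    if "a \<in> S" "b \<in> S" for a b X
    using that add_closed unfolding translate_preimage_def by (auto simp: add.assoc)
  have "translate_preimage S a {s\<in>S. translate_preimage S s X \<in> r}
      = {b\<in>S. translate_preimage S b (translate_preimage S a X) \<in> r}" if "a \<in> S" for a X
    unfolding translate_preimage_def[of S a "{s\<in>S. translate_preimage S s X \<in> r}"]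
    using that add_closed * by auto
  then have "{a\<in>S. translate_preimage S a {s\<in>S. translate_preimage S s X \<in> r} \<in> q}
      = {a\<in>S. translate_preimage S a X \<in> uf_plus S q r}" for X
    by (auto simp: uf_plus_iff translate_preimage_subset)
  then show ?thesis
    by (intro set_eqI) (auto simp: uf_plus_iff[of _ S p] uf_plus_iff[of _ S "uf_plus S p q"])
qed

text \<open>Addition is only separately continuous, so two translations are used in turn. Right
  translation by \<open>e\<close> fixes \<open>e\<close> and yields \<open>V\<close>; then, for each
  fixed \<open>s \<in> V\<close>, left translation by \<open>s\<close> carries points near
  \<open>e\<close> into \<open>O'\<close>.\<close>

lemma uf_plus_e_star:
  assumes p: "p \<in> M" and q: "q \<in> M"
  shows "uf_plus S p q \<in> M"
proof -
  note ufs = e_star_ultrafilter[OF p] e_star_ultrafilter[OF q]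
  have "U \<inter> S \<in> uf_plus S p q" if U: "U \<in> neighborhoods e" for U
  proof -
    obtain O' where O': "open O'" "e \<in> O'" "O' \<subseteq> U" using U unfolding neighborhoods_def by blast
    then have nO: "O' \<in> neighborhoods z" if "z \<in> O'" for z
      using that unfolding neighborhoods_def by blast
    define V where "V = (\<lambda>x. x + e) -` O'"
    have V: "V \<in> neighborhoods e"
      unfolding V_def using tendsto_right_translation[of e e] O' nO idem
      by (intro filterlim_nhds_neighborhoods) auto
    have "translate_preimage S s (U \<inter> S) \<in> q" if "s \<in> V \<inter> S" for s
    proof -
      have "(\<lambda>x. s + x) -` O' \<in> neighborhoods e"
        using that nO unfolding V_def
        by (intro filterlim_nhds_neighborhoods[OF tendsto_left_translation]) auto
      then have "((\<lambda>x. s + x) -` O') \<inter> S \<in> q" by (rule e_star_neighborhood[OF q])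
      then show ?thesis
        by (rule ultrafilters_mono[OF ufs(2) _ _ translate_preimage_subset])
          (use that O'(3) add_closed in \<open>auto simp: translate_preimage_def\<close>)
    qed
    then have "V \<inter> S \<subseteq> {s\<in>S. translate_preimage S s (U \<inter> S) \<in> q}" by blast
    then have "{s\<in>S. translate_preimage S s (U \<inter> S) \<in> q} \<in> p"
      by (rule ultrafilters_mono[OF ufs(1) e_star_neighborhood[OF p V]]) blast
    then show ?thesis unfolding uf_plus_iff by blast
  qed
  then show ?thesis
    using uf_plus_ultrafilter[OF ufs] unfolding e_star_def by blast
qed

text \<open>The left ideal \<open>M + p\<close> is closed in \<open>M\<close>.\<close>

lemma e_star_translate_closed:
  assumes p: "p \<in> M" and r: "r \<in> M"
    and sub: "\<And>X. (\<And>q. q \<in> M \<Longrightarrow> X \<in> uf_plus S q p) \<Longrightarrow> X \<in> r"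
  shows "\<exists>q\<in>M. uf_plus S q p = r"
proof -
  note ufs = e_star_ultrafilter[OF p] e_star_ultrafilter[OF r]
  \<comment> \<open>For \<open>X \<subseteq> S\<close>, \<open>X \<in> uf_plus S q p\<close> means
    \<open>D X \<in> q\<close>, so the wanted \<open>q\<close> only has to contain every
    \<open>D X\<close> with \<open>X \<in> r\<close>.\<close>
  define D where "D X = {s\<in>S. translate_preimage S s X \<in> p}" for X
  have "D ` r \<noteq> {}" using ultrafilters_top[OF ufs(2)] by blast
  moreover have "D ` r \<subseteq> Pow S" unfolding D_def by blast
  moreover have "e \<in> closure Y" if Y: "Y \<in> D ` r" for Y
  proof (rule ccontr)
    obtain X where X: "X \<in> r" "Y = D X" using Y by blast
    have "X \<subseteq> S" using ultrafilters_subset[OF ufs(2) X(1)] .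
    assume "e \<notin> closure Y"
    \<comment> \<open>With \<open>D X\<close> in no \<open>q \<in> M\<close>, the complement
      \<open>S - X\<close> lies in every \<open>uf_plus S q p\<close>, and \<open>sub\<close> forces
      it into \<open>r\<close>.\<close>
    then have "Y \<notin> q" if "q \<in> M" for q using e_star_closure[OF that] by blast
    then have "X \<notin> uf_plus S q p" if "q \<in> M" for q
      using that X(2) unfolding uf_plus_iff D_def by blast
    then have "S - X \<in> uf_plus S q p" if "q \<in> M" for q
      using ultrafilters_Diff_iff[OF e_star_ultrafilter[OF uf_plus_e_star[OF that p]] \<open>X \<subseteq> S\<close>] that
      by blast
    then have "S - X \<in> r" by (rule sub)
    then show False using X(1) ultrafilters_Diff_iff[OF ufs(2) \<open>X \<subseteq> S\<close>] by blast
  qed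
  moreover have "\<exists>Z\<in>D ` r. Z \<subseteq> Y \<inter> Y'" if Y: "Y \<in> D ` r" "Y' \<in> D ` r" for Y Y'
  proof -
    obtain X X' where X: "X \<in> r" "X' \<in> r" "Y = D X" "Y' = D X'" using Y by blast
    have "D Z \<subseteq> D Z'" if "Z \<subseteq> Z'" for Z Z'
      unfolding D_def
      using ultrafilters_mono[OF ufs(1) _ translate_preimage_mono[OF that] translate_preimage_subset]
      by blast
    then have "D (X \<inter> X') \<subseteq> Y \<inter> Y'"
      unfolding X by (metis Int_lower1 Int_lower2 Int_subset_iff)
    then show ?thesis using ultrafilters_Int[OF ufs(2) X(1,2)] by blast
  qed
  ultimately obtain q where q: "q \<in> M" "D ` r \<subseteq> q"
    by (rule e_star_extension)
  have "r \<subseteq> uf_plus S q p"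
    using q(2) ultrafilters_subset[OF ufs(2)] unfolding uf_plus_def D_def by blast
  then have "r = uf_plus S q p"
    by (rule ultrafilters_subset_eq[OF ufs(2) e_star_ultrafilter[OF uf_plus_e_star[OF q(1) p]]])
  then show ?thesis using q(1) by blast
qed

text \<open>
  Closed left ideals are encoded by the families \<open>\<F>\<close> of sets contained in all their members,
  so that a minimal closed left ideal corresponds to a maximal family.
\<close>

lemma minimal_left_ideal_element:
  obtains l where "l \<in> M" "\<And>q. q \<in> M \<Longrightarrow> \<exists>u\<in>M. uf_plus S u (uf_plus S q l) = l"
proof -
  define C where "C \<F> = {p\<in>M. \<F> \<subseteq> p}" for \<F>
  \<comment> \<open>Larger families cut out smaller closed left ideals. Closure under intersections
    is demanded so that the union of a chain is directed, as \<open>e_star_extension\<close>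
    requires; that lemma then keeps \<open>C\<close> of the union nonempty.\<close>
  define P where "P = {\<F>. \<F> \<noteq> {} \<and> \<F> \<subseteq> Pow S \<and> (\<forall>X\<in>\<F>. \<forall>Y\<in>\<F>. X \<inter> Y \<in> \<F>) \<and> C \<F> \<noteq> {} \<and>
    (\<forall>p\<in>C \<F>. \<forall>q\<in>M. uf_plus S q p \<in> C \<F>)}"
  have PD: "\<F> \<noteq> {}" "\<F> \<subseteq> Pow S" "\<And>X Y. X \<in> \<F> \<Longrightarrow> Y \<in> \<F> \<Longrightarrow> X \<inter> Y \<in> \<F>" "C \<F> \<noteq> {}"
    "\<And>p q. p \<in> C \<F> \<Longrightarrow> q \<in> M \<Longrightarrow> uf_plus S q p \<in> C \<F>" if "\<F> \<in> P" for \<F>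
    using that unfolding P_def by auto
  have PI: "\<F> \<in> P" if "\<F> \<noteq> {}" "\<F> \<subseteq> Pow S" "\<And>X Y. X \<in> \<F> \<Longrightarrow> Y \<in> \<F> \<Longrightarrow> X \<inter> Y \<in> \<F>"
    "C \<F> \<noteq> {}" "\<And>p q. p \<in> C \<F> \<Longrightarrow> q \<in> M \<Longrightarrow> uf_plus S q p \<in> C \<F>" for \<F>
    using that unfolding P_def by auto
  have CD: "p \<in> M" "\<F> \<subseteq> p" if "p \<in> C \<F>" for p \<F>
    using that unfolding C_def by auto
  have top: "S \<in> p" if "p \<in> M" for p
    using ultrafilters_top e_star_ultrafilter that by blast
  obtain p0 where "p0 \<in> M" using e_star_extension_single[OF order_refl in_closure] by blast
  then have "{S} \<in> P"
    unfolding P_def C_def using top uf_plus_e_star by auto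
  have "\<exists>\<F>\<in>P. \<forall>\<G>\<in>P. \<F> \<subseteq> \<G> \<longrightarrow> \<G> = \<F>"
  proof (rule subset_Zorn_nonempty)
    show "P \<noteq> {}" using \<open>{S} \<in> P\<close> by blast
    fix \<C> assume "\<C> \<noteq> {}" and chain: "subset.chain P \<C>"
    then have sub: "\<C> \<subseteq> P" and tot: "\<And>\<F> \<G>. \<F> \<in> \<C> \<Longrightarrow> \<G> \<in> \<C> \<Longrightarrow> \<F> \<subseteq> \<G> \<or> \<G> \<subseteq> \<F>"
      by (auto simp: subset_chain_def)
    have ne: "\<Union>\<C> \<noteq> {}" "\<Union>\<C> \<subseteq> Pow S" 
    proof -
      obtain \<F> where "\<F> \<in> \<C>" using \<open>\<C> \<noteq> {}\<close> by blast
      then show "\<Union>\<C> \<noteq> {}" using PD(1)[of \<F>] sub by blast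
      show "\<Union>\<C> \<subseteq> Pow S" by (rule Union_least) (use PD(2) sub in blast)
    qed
    have int: "X \<inter> Y \<in> \<Union>\<C>" if X: "X \<in> \<Union>\<C>" and Y: "Y \<in> \<Union>\<C>" for X Y
    proof -
      obtain \<F> where \<F>: "\<F> \<in> \<C>" "X \<in> \<F>" using X by blast
      obtain \<G> where \<G>: "\<G> \<in> \<C>" "Y \<in> \<G>" using Y by blast
      obtain \<H> where "\<H> \<in> \<C>" "X \<in> \<H>" "Y \<in> \<H>" using tot[OF \<F>(1) \<G>(1)] \<F> \<G> by blast
      then show ?thesis using sub PD(3) by blast
    qed
    have cl: "e \<in> closure X" if X: "X \<in> \<Union>\<C>" for X
    proof -
      obtain \<F> where \<F>: "\<F> \<in> \<C>" "X \<in> \<F>" using X by blast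
      then obtain p where p: "p \<in> C \<F>" using sub PD(4)[of \<F>] by blast
      show ?thesis using e_star_closure[OF CD(1)[OF p]] CD(2)[OF p] \<F>(2) by blast
    qed
    have dir: "\<exists>Z\<in>\<Union>\<C>. Z \<subseteq> X \<inter> Y" if "X \<in> \<Union>\<C>" "Y \<in> \<Union>\<C>" for X Y
      using int[OF that] by blast
    obtain p where "p \<in> M" "\<Union>\<C> \<subseteq> p"
      by (rule e_star_extension[OF ne cl dir])
    then have "C (\<Union>\<C>) \<noteq> {}" unfolding C_def by blast
    moreover have "uf_plus S q p \<in> C (\<Union>\<C>)" if pq: "p \<in> C (\<Union>\<C>)" "q \<in> M" for p q
    proof -
      have C_eq: "p \<in> C (\<Union>\<C>) \<longleftrightarrow> (\<forall>\<F>\<in>\<C>. p \<in> C \<F>)" for p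
        using \<open>\<C> \<noteq> {}\<close> unfolding C_def by blast
      have "uf_plus S q p \<in> C \<F>" if "\<F> \<in> \<C>" for \<F>
        using PD(5)[of \<F> p q] that sub pq unfolding C_eq by blast
      then show "uf_plus S q p \<in> C (\<Union>\<C>)" unfolding C_eq by blast
    qed
    ultimately show "\<Union>\<C> \<in> P" using ne int by (intro PI)
  qed
  then obtain \<F> where "\<F> \<in> P" and max: "\<And>\<G>. \<G> \<in> P \<Longrightarrow> \<F> \<subseteq> \<G> \<Longrightarrow> \<G> = \<F>" by blast
  note ideal = PD(5)[OF \<open>\<F> \<in> P\<close>]
  have cover: "\<exists>u\<in>M. uf_plus S u p = r" if p: "p \<in> C \<F>" and r: "r \<in> C \<F>" for p r
  proof -
    have "p \<in> M" "r \<in> M" using p r CD by auto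
    \<comment> \<open>\<open>\<G>\<close> encodes the left ideal \<open>M + p\<close>: by
      \<open>mem\<close> and \<open>closed\<close>, \<open>C \<G>\<close> consists of exactly the
      sums \<open>uf_plus S u p\<close> with \<open>u \<in> M\<close>. This ideal lies inside
      \<open>C \<F>\<close>, so maximality gives \<open>\<G> = \<F>\<close> and every
      \<open>r \<in> C \<F>\<close> is such a sum.\<close>
    define \<G> where "\<G> = {X. \<forall>q\<in>M. X \<in> uf_plus S q p}"
    have uf: "uf_plus S q p \<in> ultrafilters S" if "q \<in> M" for q
      using e_star_ultrafilter uf_plus_e_star that \<open>p \<in> M\<close> by blast
    have mem: "uf_plus S q p \<in> C \<G>" if "q \<in> M" for q
      unfolding C_def \<G>_def using that uf_plus_e_star \<open>p \<in> M\<close> by blast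
    have closed: "\<exists>u\<in>M. uf_plus S u p = t" if "t \<in> M" "\<G> \<subseteq> t" for t
      by (rule e_star_translate_closed[OF \<open>p \<in> M\<close> \<open>t \<in> M\<close>]) (use \<open>\<G> \<subseteq> t\<close> in \<open>auto simp: \<G>_def\<close>)
    have "\<F> \<subseteq> \<G>" using CD(2)[OF ideal[OF p]] unfolding \<G>_def by blast
    have "\<G> \<in> P"
    proof (rule PI)
      show "\<G> \<noteq> {}" using top uf_plus_e_star \<open>p \<in> M\<close> unfolding \<G>_def by blast
      show "\<G> \<subseteq> Pow S" using \<open>p \<in> M\<close> unfolding \<G>_def uf_plus_iff by blast
      show "X \<inter> Y \<in> \<G>" if "X \<in> \<G>" "Y \<in> \<G>" for X Y
        using that ultrafilters_Int[OF uf] unfolding \<G>_def by blast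
      show "C \<G> \<noteq> {}" using mem \<open>p \<in> M\<close> by blast
      fix t q assume "t \<in> C \<G>" "q \<in> M"
      then obtain u where u: "u \<in> M" "uf_plus S u p = t"
        using closed[OF CD] by blast
      then have "uf_plus S q t = uf_plus S (uf_plus S q u) p"
        by (simp add: uf_plus_assoc)
      then show "uf_plus S q t \<in> C \<G>" using mem uf_plus_e_star[OF \<open>q \<in> M\<close> u(1)] by simp
    qed
    then have "\<G> = \<F>" using max \<open>\<F> \<subseteq> \<G>\<close> by blast
    then show ?thesis using closed[OF \<open>r \<in> M\<close>] CD(2)[OF r] by simp
  qed
  obtain l where l: "l \<in> C \<F>" using PD(4)[OF \<open>\<F> \<in> P\<close>] by blast
  show thesis
  proof (rule that[of l])
    show "l \<in> M" using l by (rule CD)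
    show "\<exists>u\<in>M. uf_plus S u (uf_plus S q l) = l" if "q \<in> M" for q
      using cover[OF ideal[OF l that] l] .
  qed
qed

lemma K_ideal: "is_ideal (uf_plus S) M K"
  and K_iff: "p \<in> K \<longleftrightarrow> p \<in> M \<and> (\<forall>q\<in>M. \<exists>u\<in>M. uf_plus S u (uf_plus S q p) = p)"
proof -
  obtain l where l: "l \<in> M" "\<And>q. q \<in> M \<Longrightarrow> \<exists>u\<in>M. uf_plus S u (uf_plus S q l) = l"
    using minimal_left_ideal_element by blast
  note * = smallest_ideal_characterization[OF uf_plus_e_star uf_plus_assoc l]
  show "is_ideal (uf_plus S) M K"
    by (rule *(1))
  show "p \<in> K \<longleftrightarrow> p \<in> M \<and> (\<forall>q\<in>M. \<exists>u\<in>M. uf_plus S u (uf_plus S q p) = p)"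
    by (rule *(2))
qed

lemma K_left: "m \<in> M \<Longrightarrow> p \<in> K \<Longrightarrow> uf_plus S m p \<in> K"
  and K_right: "m \<in> M \<Longrightarrow> p \<in> K \<Longrightarrow> uf_plus S p m \<in> K"
  and K_nonempty: "K \<noteq> {}"
  and K_e_star: "p \<in> K \<Longrightarrow> p \<in> M"
  using K_ideal unfolding is_ideal_def by blast+

lemma K_ultrafilter: "p \<in> K \<Longrightarrow> p \<in> ultrafilters S"
  using K_e_star e_star_ultrafilter by blast

section \<open>Piecewise syndetic sets near an idempotent\<close>

text \<open>Some \<open>p \<in> M\<close> contains, for every finite \<open>G\<close>, the set
  \<open>R G\<close> of points serving \<open>G\<close>. For \<open>k \<in> K\<close> the sum
  \<open>r\<close> of \<open>k\<close> and \<open>p\<close> then contains every \<open>Q n\<close>,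
  hence the preimage of \<open>A\<close> under translation by some element of
  \<open>F n\<close>.\<close>

lemma piecewise_syndetic_imp_mem_K:
  assumes "piecewise_syndetic_near S e A"
  obtains p where "p \<in> K" "A \<in> p"
proof -
  obtain W where W: "decreasing_local_base e W" and PS: "piecewise_syndetic_wrt W S e A"
    using assms unfolding piecewise_syndetic_near_def by blast
  from PS have "A \<subseteq> S" unfolding piecewise_syndetic_wrt_def by (rule conjunct1)
  obtain F V where F: "\<forall>n. finite (F n) \<and> F n \<noteq> {} \<and> F n \<subseteq> W n \<inter> S"
    and V: "\<forall>n. V n \<in> neighborhoods e \<and> V n \<subseteq> W n"
    and ex: "\<forall>G O'. finite G \<and> G \<noteq> {} \<and> G \<subseteq> S \<and> O' \<in> neighborhoods e \<longrightarrow>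
      (\<exists>x\<in>O' \<inter> S. \<forall>n. (\<lambda>g. g + x) ` (G \<inter> V n) \<subseteq> (\<Union>t\<in>F n. translate_preimage S t A))"
    using PS unfolding piecewise_syndetic_wrt_def by (elim conjE exE) (rule that; assumption)
  define Q where "Q n = (\<Union>t\<in>F n. translate_preimage S t A)" for n
  define R where "R G = {x\<in>S. \<forall>n. \<forall>g\<in>G \<inter> V n. g + x \<in> Q n}" for G
  define \<A> where "\<A> = R ` {G. finite G \<and> G \<noteq> {} \<and> G \<subseteq> S}"
  have \<A>I: "R G \<in> \<A>" if "finite G" "G \<noteq> {}" "G \<subseteq> S" for G
    unfolding \<A>_def using that by blast
  obtain s0 where "s0 \<in> S" using in_closure by fastforce
  then have "\<A> \<noteq> {}" using \<A>I[of "{s0}"] by blast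
  moreover have "\<A> \<subseteq> Pow S" unfolding \<A>_def R_def by blast
  moreover have "e \<in> closure X" if X: "X \<in> \<A>" for X
    unfolding closure_iff_neighborhoods
  proof
    fix U assume U: "U \<in> neighborhoods e"
    obtain G where G: "finite G" "G \<noteq> {}" "G \<subseteq> S" "X = R G" using X unfolding \<A>_def by blast
    have "\<exists>x\<in>U \<inter> S. \<forall>n. (\<lambda>g. g + x) ` (G \<inter> V n) \<subseteq> Q n"
      using ex[rule_format, of G U] G(1-3) U unfolding Q_def by simp
    then obtain x where x: "x \<in> U \<inter> S" "\<And>n. (\<lambda>g. g + x) ` (G \<inter> V n) \<subseteq> Q n" by metis
    then have "x \<in> U \<inter> X" unfolding G(4) R_def by blast
    then show "U \<inter> X \<noteq> {}" by blast
  qed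
  moreover have "\<exists>Z\<in>\<A>. Z \<subseteq> X \<inter> Y" if XY: "X \<in> \<A>" "Y \<in> \<A>" for X Y
  proof -
    obtain G H where GH: "finite G" "G \<noteq> {}" "G \<subseteq> S" "X = R G" "finite H" "H \<subseteq> S" "Y = R H"
      using XY unfolding \<A>_def by blast
    then have "R (G \<union> H) \<in> \<A>" by (intro \<A>I) auto
    moreover have "R (G \<union> H) \<subseteq> X \<inter> Y" unfolding GH R_def by blast
    ultimately show ?thesis by blast
  qed
  ultimately obtain p where p: "p \<in> M" "\<A> \<subseteq> p"
    by (rule e_star_extension)
  obtain k where "k \<in> K" using K_nonempty by blast
  then have "k \<in> M" by (rule K_e_star)
  define r where "r = uf_plus S k p"
  have "r \<in> K" unfolding r_def using K_right \<open>k \<in> K\<close> p(1) by blast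
  have Q: "Q n \<in> r" for n
  proof -
    have QS: "Q n \<subseteq> S" unfolding Q_def using translate_preimage_subset by blast
    have "translate_preimage S g (Q n) \<in> p" if g: "g \<in> V n \<inter> S" for g
    proof (rule ultrafilters_mono[OF e_star_ultrafilter[OF p(1)] _ _ translate_preimage_subset])
      show "R {g} \<in> p" using g p(2) \<A>I[of "{g}"] by blast
      show "R {g} \<subseteq> translate_preimage S g (Q n)"
        using g unfolding R_def translate_preimage_def by blast
    qed
    then have "V n \<inter> S \<subseteq> {s\<in>S. translate_preimage S s (Q n) \<in> p}" by blast
    moreover have "V n \<inter> S \<in> k" using e_star_neighborhood[OF \<open>k \<in> M\<close>] V by blast
    ultimately have "{s\<in>S. translate_preimage S s (Q n) \<in> p} \<in> k"
      using ultrafilters_mono[OF e_star_ultrafilter[OF \<open>k \<in> M\<close>]] by blast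
    then show ?thesis unfolding r_def uf_plus_iff using QS by blast
  qed
  \<comment> \<open>\<open>A \<in> uf_plus S q r\<close> holds once \<open>E \<in> q\<close>. Such a
    \<open>q\<close> exists because \<open>E\<close> meets each \<open>F n\<close>, and
    \<open>F n\<close> lies in \<open>W n\<close>.\<close>
  define E where "E = {t\<in>S. translate_preimage S t A \<in> r}"
  have "e \<in> closure E"
    unfolding closure_iff_neighborhoods
  proof
    fix U assume "U \<in> neighborhoods e"
    then obtain n where "W n \<subseteq> U"
      using W unfolding decreasing_local_base_def local_base_def by blast
    have "finite (F n)" using F by blast
    then obtain t where "t \<in> F n" "translate_preimage S t A \<in> r"
      using ultrafilters_UN[OF K_ultrafilter[OF \<open>r \<in> K\<close>]] Q[of n] unfolding Q_def by blast
    then have "t \<in> U \<inter> E" using F \<open>W n \<subseteq> U\<close> unfolding E_def by blast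
    then show "U \<inter> E \<noteq> {}" by blast
  qed
  moreover have "E \<subseteq> S" unfolding E_def by blast
  ultimately obtain q where q: "q \<in> M" "E \<in> q"
    using e_star_extension_single[of E S e] by blast
  have "A \<in> uf_plus S q r"
    using \<open>A \<subseteq> S\<close> q(2) unfolding uf_plus_iff E_def by blast
  then show thesis using that K_left[OF q(1) \<open>r \<in> K\<close>] by blast
qed

text \<open>For \<open>q \<in> M\<close>, recover \<open>p\<close> from \<open>uf_plus S q p\<close>
  by adding some \<open>u\<close> on the left. As \<open>A \<in> p\<close>, the elements
  \<open>s\<close> whose translation preimage of \<open>A\<close> lies in
  \<open>uf_plus S q p\<close> form a member of \<open>u\<close>, so they occur arbitrarily near
  \<open>e\<close>. Compactness over all \<open>q\<close> reduces the choices of \<open>s\<close> to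
  a finite \<open>F n\<close> valid on a neighborhood \<open>V n\<close>.\<close>

lemma mem_K_imp_piecewise_syndetic:
  assumes W: "decreasing_local_base e W" and "p \<in> K" "A \<in> p"
  shows "piecewise_syndetic_near S e A"
proof -
  have "p \<in> M" using \<open>p \<in> K\<close> by (rule K_e_star)
  note p_uf = K_ultrafilter[OF \<open>p \<in> K\<close>]
  have "A \<subseteq> S" using ultrafilters_subset[OF p_uf \<open>A \<in> p\<close>] .
  have W_nb: "W n \<in> neighborhoods e" for n
    using W unfolding decreasing_local_base_def local_base_def by blast
  \<comment> \<open>\<open>X s \<in> q\<close> expresses
    \<open>translate_preimage S s A \<in> uf_plus S q p\<close>.\<close>
  define X where "X s = {x\<in>S. translate_preimage S x (translate_preimage S s A) \<in> p}" for s
  have "\<exists>F V. finite F \<and> F \<noteq> {} \<and> F \<subseteq> W n \<inter> S \<and> V \<in> neighborhoods e \<and> V \<subseteq> W n \<and>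
      V \<inter> S \<subseteq> (\<Union>s\<in>F. X s)" for n
  proof -
    have "\<exists>s\<in>W n \<inter> S. X s \<in> q" if q: "q \<in> M" for q
    proof -
      obtain u where u: "u \<in> M" "uf_plus S u (uf_plus S q p) = p"
        using \<open>p \<in> K\<close> q K_iff by blast
      then have "{s\<in>S. translate_preimage S s A \<in> uf_plus S q p} \<in> u"
        using \<open>A \<in> p\<close> uf_plus_iff[of A S u "uf_plus S q p"] by simp
      then have "e \<in> closure {s\<in>S. translate_preimage S s A \<in> uf_plus S q p}"
        by (rule e_star_closure[OF u(1)])
      then obtain s where "s \<in> W n \<inter> S" "translate_preimage S s A \<in> uf_plus S q p"
        using W_nb[of n] unfolding closure_iff_neighborhoods by blast
      then show ?thesis unfolding uf_plus_iff X_def by blast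
    qed
    then obtain F V where FV: "finite F" "F \<subseteq> W n \<inter> S" "V \<in> neighborhoods e" "V \<inter> S \<subseteq> (\<Union>s\<in>F. X s)"
      using e_star_finite_cover[of S e "W n \<inter> S" X] by blast
    \<comment> \<open>Inserting \<open>w\<close> makes the finite set visibly nonempty.\<close>
    obtain w where "w \<in> W n \<inter> S"
      using in_closure W_nb[of n] unfolding closure_iff_neighborhoods by blast
    then show ?thesis
      using FV W_nb[of n]
      by (intro exI[of _ "insert w F"] exI[of _ "V \<inter> W n"] conjI neighborhoods_Int) auto
  qed
  then obtain F V where F: "\<And>n. finite (F n)" "\<And>n. F n \<noteq> {}" "\<And>n. F n \<subseteq> W n \<inter> S"
    and V: "\<And>n. V n \<in> neighborhoods e" "\<And>n. V n \<subseteq> W n" "\<And>n. V n \<inter> S \<subseteq> (\<Union>s\<in>F n. X s)"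
    by metis
  define Q where "Q n = (\<Union>t\<in>F n. translate_preimage S t A)" for n
  have Q: "translate_preimage S g (Q n) \<in> p" if g: "g \<in> V n \<inter> S" for g n
  proof -
    obtain s where s: "s \<in> F n" "g \<in> X s" using V(3)[of n] g by blast
    then have "translate_preimage S g (translate_preimage S s A) \<in> p" unfolding X_def by blast
    moreover have "translate_preimage S s A \<subseteq> Q n" unfolding Q_def using s(1) by blast
    ultimately show ?thesis
      using ultrafilters_mono[OF p_uf _ translate_preimage_mono translate_preimage_subset] by blast
  qed
  text \<open>
    Each \<open>g \<in> S\<close> differs from \<open>e\<close>, so it lies in only finitely many \<open>V n\<close>; hence a single \<open>x\<close>
    can serve all \<open>n\<close> at once.
  \<close>
  have fin: "finite {n. g \<in> V n}" if "g \<in> S" for g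
  proof -
    have "open (- {g})" "e \<in> - {g}" using not_mem that by auto
    then have "- {g} \<in> neighborhoods e" unfolding neighborhoods_def by blast
    then obtain n where n: "W n \<subseteq> - {g}"
      using W unfolding decreasing_local_base_def local_base_def by blast
    have "decseq W" using W unfolding decreasing_local_base_def by blast
    have "g \<notin> V m" if "n \<le> m" for m
      using V(2)[of m] decseqD[OF \<open>decseq W\<close> that] n by blast
    then have "{n. g \<in> V n} \<subseteq> {..<n}" by (auto simp: not_less[symmetric])
    then show ?thesis by (rule finite_subset) simp
  qed
  have x_ex: "\<exists>x\<in>O' \<inter> S. \<forall>n. (\<lambda>g. g + x) ` (G \<inter> V n) \<subseteq> Q n"
    if G: "finite G" "G \<subseteq> S" and O': "O' \<in> neighborhoods e" for G O'
  proof -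
    define N where "N = (SIGMA g:G. {n. g \<in> V n})"
    define Y where "Y = S \<inter> (\<Inter>gn\<in>N. translate_preimage S (fst gn) (Q (snd gn)))"
    have "finite N" unfolding N_def using G fin by (intro finite_SigmaI) auto
    then have "Y \<in> p" unfolding Y_def
      by (rule ultrafilters_INT[OF p_uf]) (use G Q in \<open>auto simp: N_def\<close>)
    then have "O' \<inter> S \<inter> Y \<in> p"
      by (rule ultrafilters_Int[OF p_uf e_star_neighborhood[OF \<open>p \<in> M\<close> O']])
    then have "O' \<inter> S \<inter> Y \<noteq> {}"
      using ultrafilters_empty[OF p_uf] by metis
    then obtain x where x: "x \<in> O' \<inter> S" "x \<in> Y" by blast
    have "g + x \<in> Q n" if "g \<in> G" "g \<in> V n" for g n
    proof -
      have "(g, n) \<in> N" unfolding N_def using that by blast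
      then have "x \<in> translate_preimage S g (Q n)" using x(2) unfolding Y_def by fastforce
      then show ?thesis unfolding translate_preimage_def by blast
    qed
    then show ?thesis using x(1) by blast
  qed
  have "piecewise_syndetic_wrt W S e A"
    unfolding piecewise_syndetic_wrt_def
  proof (rule conjI[OF \<open>A \<subseteq> S\<close>], rule exI[of _ F], rule exI[of _ V], intro conjI allI impI)
    fix G O'
    assume "finite G \<and> G \<noteq> {} \<and> G \<subseteq> S \<and> O' \<in> neighborhoods e"
    then show "\<exists>x\<in>O' \<inter> S. \<forall>n. (\<lambda>g. g + x) ` (G \<inter> V n) \<subseteq> (\<Union>t\<in>F n. translate_preimage S t A)"
      using x_ex[of G O'] unfolding Q_def by simp
  qed (use F V in blast)+
  then show ?thesis using W unfolding piecewise_syndetic_near_def by blast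
qed

section \<open>The star notions read off from the ultrafilters in \<open>K\<close>\<close>

lemma central_star_near_iff:
  "central_star_near S e B \<longleftrightarrow> B \<subseteq> S \<and> (\<forall>p\<in>K. uf_plus S p p = p \<longrightarrow> B \<in> p)"
proof (intro iffI conjI ballI impI)
  assume B: "central_star_near S e B"
  then show "B \<subseteq> S" unfolding central_star_near_def by blast
  fix p assume p: "p \<in> K" "uf_plus S p p = p"
  show "B \<in> p"
  proof (rule ccontr)
    assume "B \<notin> p"
    then have "S - B \<in> p"
      using ultrafilters_Diff_iff[OF K_ultrafilter[OF p(1)] \<open>B \<subseteq> S\<close>] by blast
    then have "central_near S e (S - B)" using p unfolding central_near_def by blast
    then show False using B unfolding central_star_near_def by blast
  qed
next
  assume B: "B \<subseteq> S \<and> (\<forall>p\<in>K. uf_plus S p p = p \<longrightarrow> B \<in> p)"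
  have "B \<inter> C \<noteq> {}" if C: "central_near S e C" for C
  proof -
    obtain p where "p \<in> K" "uf_plus S p p = p" "C \<in> p" using C unfolding central_near_def by blast
    then show ?thesis using B K_ultrafilter ultrafilters_Int ultrafilters_empty by metis
  qed
  then show "central_star_near S e B" using B unfolding central_star_near_def by blast
qed

lemma PS_star_nearI:
  assumes "B \<subseteq> S" "\<And>p. p \<in> K \<Longrightarrow> B \<in> p"
  shows "PS_star_near S e B"
proof -
  have "B \<inter> C \<noteq> {}" if C: "piecewise_syndetic_near S e C" for C
  proof -
    obtain p where "p \<in> K" "C \<in> p" using piecewise_syndetic_imp_mem_K[OF C] .
    then show ?thesis using assms(2) K_ultrafilter ultrafilters_Int ultrafilters_empty by metis
  qed
  then show ?thesis using assms(1) unfolding PS_star_near_def by blast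
qed

text \<open>Otherwise \<open>S - B\<close> would be a member of \<open>p\<close>, hence a piecewise
  syndetic set disjoint from \<open>B\<close>. The base \<open>W\<close> is what
  \<open>mem_K_imp_piecewise_syndetic\<close> asks for.\<close>

lemma PS_star_nearD:
  assumes W: "decreasing_local_base e W" and B: "PS_star_near S e B" and "p \<in> K"
  shows "B \<in> p"
proof (rule ccontr)
  assume "B \<notin> p"
  moreover have "B \<subseteq> S" using B unfolding PS_star_near_def by blast
  ultimately have "S - B \<in> p"
    using ultrafilters_Diff_iff[OF K_ultrafilter[OF \<open>p \<in> K\<close>]] by blast
  then have "piecewise_syndetic_near S e (S - B)"
    by (rule mem_K_imp_piecewise_syndetic[OF W \<open>p \<in> K\<close>])
  then show False using B unfolding PS_star_near_def by blast
qed

end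

section \<open>Images of ultrafilters\<close>

text \<open>The pushforward of \<open>r\<close> along \<open>h\<close>: when \<open>h\<close> maps
  \<open>I\<close> into \<open>S\<close>, this is the canonical extension of \<open>h\<close> to
  ultrafilters.\<close>

definition uf_image :: "'b set \<Rightarrow> 'a set \<Rightarrow> ('b \<Rightarrow> 'a) \<Rightarrow> 'b set set \<Rightarrow> 'a set set" where
  "uf_image I S h r = {X. X \<subseteq> S \<and> {v\<in>I. h v \<in> X} \<in> r}"

lemma uf_image_ultrafilter:
  assumes r: "r \<in> ultrafilters I" and h: "h ` I \<subseteq> S"
  shows "uf_image I S h r \<in> ultrafilters S"
proof -
  let ?D = "\<lambda>X. {v\<in>I. h v \<in> X}"
  have iff: "X \<in> uf_image I S h r \<longleftrightarrow> X \<subseteq> S \<and> ?D X \<in> r" for X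
    unfolding uf_image_def by simp
  have top: "?D S = I" using h by blast
  have int: "?D (X \<inter> Y) = ?D X \<inter> ?D Y" for X Y by blast
  have diff: "?D (S - X) = I - ?D X" for X using h by blast
  show ?thesis
    unfolding ultrafilters_def mem_Collect_eq
  proof (intro conjI ballI allI impI)
    show "uf_image I S h r \<subseteq> Pow S" unfolding uf_image_def by blast
    show "S \<in> uf_image I S h r" "{} \<notin> uf_image I S h r"
      unfolding iff top using ultrafilters_top[OF r] ultrafilters_empty[OF r] by auto
    show "X \<inter> Y \<in> uf_image I S h r" if "X \<in> uf_image I S h r" "Y \<in> uf_image I S h r" for X Y
      using that ultrafilters_Int[OF r] unfolding iff int by blast
    show "Y \<in> uf_image I S h r" if XY: "X \<in> uf_image I S h r" "X \<subseteq> Y \<and> Y \<subseteq> S" for X Y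
    proof -
      have "?D Y \<in> r"
        by (rule ultrafilters_mono[OF r, of "?D X"]) (use XY in \<open>auto simp: iff\<close>)
      then show ?thesis using XY unfolding iff by blast
    qed
    show "X \<in> uf_image I S h r \<or> S - X \<in> uf_image I S h r" if "X \<subseteq> S" for X
      using that ultrafilters_Diff_iff[OF r, of "?D X"] unfolding iff diff by blast
  qed
qed

text \<open>By additivity, translating a preimage under \<open>h\<close> by \<open>v\<close> gives
  the preimage of the translate by \<open>h v\<close>. This carries \<open>h\<close> through both
  membership layers of \<open>uf_plus\<close>.\<close>

lemma uf_image_uf_plus:
  assumes h: "h ` I \<subseteq> S" and add: "\<And>v w. v \<in> I \<Longrightarrow> w \<in> I \<Longrightarrow> h (v + w) = h v + h w"
    and closed: "\<And>v w. v \<in> I \<Longrightarrow> w \<in> I \<Longrightarrow> v + w \<in> I"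
  shows "uf_image I S h (uf_plus I r r') = uf_plus S (uf_image I S h r) (uf_image I S h r')"
proof -
  have "translate_preimage I v {w\<in>I. h w \<in> X} = {w\<in>I. h w \<in> translate_preimage S (h v) X}"
    if "v \<in> I" for v X
    using that h add closed unfolding translate_preimage_def by auto
  then have "{v\<in>I. translate_preimage I v {w\<in>I. h w \<in> X} \<in> r'}
      = {v\<in>I. h v \<in> {s\<in>S. translate_preimage S s X \<in> uf_image I S h r'}}" for X
    using h by (auto simp: uf_image_def translate_preimage_subset)
  then show ?thesis
    by (auto simp: uf_image_def[of I S h "uf_plus I r r'"] uf_image_def[of I S h r] uf_plus_iff)
qed

lemma uf_image_e_star:
  assumes r: "r \<in> e_star I a" and h: "h ` I \<subseteq> S" and lim: "filterlim h (nhds e) (nhds a)"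
  shows "uf_image I S h r \<in> e_star S e"
proof -
  have "U \<inter> S \<in> uf_image I S h r" if "U \<in> neighborhoods e" for U
  proof -
    have "h -` U \<inter> I \<in> r"
      by (rule e_star_neighborhood[OF r filterlim_nhds_neighborhoods[OF lim that]])
    moreover have "h -` U \<inter> I = {v\<in>I. h v \<in> U \<inter> S}" using h by blast
    ultimately show ?thesis unfolding uf_image_def by simp
  qed
  then show ?thesis
    using uf_image_ultrafilter[OF e_star_ultrafilter[OF r] h] unfolding e_star_def by blast
qed

text \<open>The image of \<open>I\<close> belongs to \<open>k\<close>, so members of
  \<open>k\<close> still accumulate at \<open>e\<close> after restriction to it, and
  \<open>lift\<close> makes their preimages accumulate at \<open>a\<close>. An ultrafilter
  \<open>k'\<close> containing all these preimages has a pushforward containing \<open>k\<close>,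
  hence equal to \<open>k\<close>.\<close>

lemma uf_image_lift:
  assumes h: "h ` I \<subseteq> S" and k: "k \<in> e_star S e" "h ` I \<in> k"
    and lift: "\<And>E. E \<subseteq> h ` I \<Longrightarrow> e \<in> closure E \<Longrightarrow> a \<in> closure {v\<in>I. h v \<in> E}"
  obtains k' where "k' \<in> e_star I a" "uf_image I S h k' = k"
proof -
  note k_uf = e_star_ultrafilter[OF k(1)]
  define \<A> where "\<A> = (\<lambda>X. {v\<in>I. h v \<in> X}) ` k"
  have "\<A> \<noteq> {}" "\<A> \<subseteq> Pow I" using k(2) unfolding \<A>_def by blast+
  moreover have "a \<in> closure Y" if Y: "Y \<in> \<A>" for Y
  proof -
    obtain X where X: "X \<in> k" "Y = {v\<in>I. h v \<in> X}" using Y unfolding \<A>_def by blast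
    have "e \<in> closure (X \<inter> h ` I)"
      by (rule e_star_closure[OF k(1) ultrafilters_Int[OF k_uf X(1) k(2)]])
    then have "a \<in> closure {v\<in>I. h v \<in> X \<inter> h ` I}" by (intro lift) auto
    moreover have "{v\<in>I. h v \<in> X \<inter> h ` I} = Y" using X by blast
    ultimately show ?thesis by simp
  qed
  moreover have "\<exists>Z\<in>\<A>. Z \<subseteq> Y \<inter> Y'" if Y: "Y \<in> \<A>" "Y' \<in> \<A>" for Y Y'
  proof -
    obtain X X' where X: "X \<in> k" "Y = {v\<in>I. h v \<in> X}" "X' \<in> k" "Y' = {v\<in>I. h v \<in> X'}"
      using Y unfolding \<A>_def by blast
    then have "{v\<in>I. h v \<in> X \<inter> X'} \<in> \<A>"
      unfolding \<A>_def using ultrafilters_Int[OF k_uf] by blast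
    then show ?thesis using X by (intro bexI[of _ "{v\<in>I. h v \<in> X \<inter> X'}"]) auto
  qed
  ultimately obtain k' where k': "k' \<in> e_star I a" "\<A> \<subseteq> k'"
    by (rule e_star_extension)
  have "k \<subseteq> uf_image I S h k'"
    using k'(2) ultrafilters_subset[OF k_uf] unfolding \<A>_def uf_image_def by blast
  then have "k = uf_image I S h k'"
    by (rule ultrafilters_subset_eq[OF k_uf uf_image_ultrafilter[OF e_star_ultrafilter[OF k'(1)] h]])
  then show thesis using that k'(1) by blast
qed

text \<open>A homomorphism maps smallest ideal into smallest ideal once its range meets the target
  one; \<open>PS\<close> and \<open>lift\<close> together provide the common element
  \<open>k\<close>.\<close>

lemma uf_image_smallest_ideal:
  fixes I :: "'b::semitopological_semigroup_add set"
    and S :: "'a::semitopological_semigroup_add set"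
  assumes "near_subsemigroup S e" "near_subsemigroup I a"
    and h: "h ` I \<subseteq> S" and add: "\<And>v w. v \<in> I \<Longrightarrow> w \<in> I \<Longrightarrow> h (v + w) = h v + h w"
    and lim: "filterlim h (nhds e) (nhds a)"
    and PS: "piecewise_syndetic_near S e (h ` I)"
    and lift: "\<And>E. E \<subseteq> h ` I \<Longrightarrow> e \<in> closure E \<Longrightarrow> a \<in> closure {v\<in>I. h v \<in> E}"
    and r: "r \<in> smallest_ideal (uf_plus I) (e_star I a)"
  shows "uf_image I S h r \<in> smallest_ideal (uf_plus S) (e_star S e)"
proof -
  interpret S: near_idempotent S e by unfold_locales fact
  interpret I: near_idempotent I a by unfold_locales fact
  note hom = uf_image_uf_plus[of h I S, OF h add I.add_closed]
  obtain k where k: "k \<in> S.K" "h ` I \<in> k" using S.piecewise_syndetic_imp_mem_K[OF PS] .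
  obtain k' where k': "k' \<in> I.M" "uf_image I S h k' = k"
    using uf_image_lift[OF h S.K_e_star[OF k(1)] k(2) lift] .
  obtain u where u: "u \<in> I.M" "uf_plus I u (uf_plus I k' r) = r"
    using r k'(1) I.K_iff by blast
  have eq: "uf_plus S (uf_image I S h u) (uf_plus S k (uf_image I S h r)) = uf_image I S h r"
    using hom[of u "uf_plus I k' r"] hom[of k' r] u(2) k'(2) by simp
  have "uf_plus S k (uf_image I S h r) \<in> S.K"
    by (rule S.K_right[OF uf_image_e_star[OF I.K_e_star[OF r] h lim] k(1)])
  from S.K_left[OF uf_image_e_star[OF u(1) h lim] this] show ?thesis
    unfolding eq .
qed

section \<open>Transfer to the power along the coordinate projections\<close>

theorem theorem3p5:
  fixes S B :: "'a::semitopological_semigroup_add set"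
    and e :: 'a
    and I :: "('a ^ 'l::finite) set"
  assumes "near_subsemigroup S e"
    and "\<exists>\<B>. countable \<B> \<and> local_base e \<B>"
    and "I \<subseteq> {v. \<forall>i. v $ i \<in> S}"
    and "near_subsemigroup I (\<chi> i. e)"
    and "\<And>i. piecewise_syndetic_near S e ((\<lambda>v. v $ i) ` I)"
    and "\<And>i E. E \<subseteq> (\<lambda>v. v $ i) ` I \<Longrightarrow> e \<in> closure E \<Longrightarrow>
           (\<chi> i. e) \<in> closure {v\<in>I. v $ i \<in> E}"
    and "B \<subseteq> S"
  shows "(central_star_near S e B \<longrightarrow>
            central_star_near I (\<chi> i. e) ({v. \<forall>i. v $ i \<in> B} \<inter> I)) \<and>
         (PS_star_near S e B \<longrightarrow>
            PS_star_near I (\<chi> i. e) ({v. \<forall>i. v $ i \<in> B} \<inter> I))"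
proof -
  interpret S: near_idempotent S e by unfold_locales fact
  interpret I: near_idempotent I "(\<chi> i. e) :: 'a ^ 'l" by unfold_locales fact
  \<comment> \<open>Piecewise syndeticity of a projection comes with a decreasing base, which
    \<open>S.PS_star_nearD\<close> takes as input.\<close>
  obtain W where W: "decreasing_local_base e W"
    using assms(5) unfolding piecewise_syndetic_near_def by blast
  let ?\<phi> = "\<lambda>i. uf_image I S (\<lambda>v. v $ i)"
  have h: "(\<lambda>v. v $ i) ` I \<subseteq> S" for i using assms(3) by blast
  have lim: "filterlim (\<lambda>v. v $ i) (nhds e) (nhds ((\<chi> i. e) :: 'a ^ 'l))" for i
    using tendsto_vec_nth[of "\<lambda>v. v" "(\<chi> i. e) :: 'a ^ 'l" _ i, OF filterlim_ident] by simp
  have \<phi>_K: "?\<phi> i r \<in> S.K" if "r \<in> I.K" for i r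
    by (rule uf_image_smallest_ideal[OF assms(1,4) h _ lim assms(5,6) that]) simp_all
  \<comment> \<open>This serves the central half, where \<open>B\<close> is known to lie only in the
    idempotent elements of \<open>S.K\<close>.\<close>
  have \<phi>_idem: "uf_plus S (?\<phi> i r) (?\<phi> i r) = ?\<phi> i r" if "uf_plus I r r = r" for i r
    using uf_image_uf_plus[of "\<lambda>v. v $ i" I S r r, OF h _ I.add_closed] that by simp
  have power: "{v. \<forall>i. v $ i \<in> B} \<inter> I \<in> r" if "r \<in> I.K" "\<And>i. B \<in> ?\<phi> i r" for r
  proof -
    \<comment> \<open>The index type is finite, so this is a finite intersection of members of
      \<open>r\<close>.\<close>
    have "I \<inter> (\<Inter>i. {v\<in>I. v $ i \<in> B}) \<in> r"
      using that(2) by (intro ultrafilters_INT[OF I.K_ultrafilter[OF that(1)]]) (auto simp: uf_image_def)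
    moreover have "I \<inter> (\<Inter>i. {v\<in>I. v $ i \<in> B}) = {v. \<forall>i. v $ i \<in> B} \<inter> I" by blast
    ultimately show ?thesis by simp
  qed
  show ?thesis
  proof (intro conjI impI)
    assume "central_star_near S e B"
    then have B: "B \<in> p" if "p \<in> S.K" "uf_plus S p p = p" for p
      using that unfolding S.central_star_near_iff by blast
    have "{v. \<forall>i. v $ i \<in> B} \<inter> I \<in> r" if "r \<in> I.K" "uf_plus I r r = r" for r
      by (rule power[OF that(1) B[OF \<phi>_K[OF that(1)] \<phi>_idem[OF that(2)]]])
    then show "central_star_near I (\<chi> i. e) ({v. \<forall>i. v $ i \<in> B} \<inter> I)"
      unfolding I.central_star_near_iff by blast
  next
    assume B: "PS_star_near S e B"
    show "PS_star_near I (\<chi> i. e) ({v. \<forall>i. v $ i \<in> B} \<inter> I)"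
    proof (rule I.PS_star_nearI)
      show "{v. \<forall>i. v $ i \<in> B} \<inter> I \<in> r" if "r \<in> I.K" for r
        by (rule power[OF that S.PS_star_nearD[OF W B \<phi>_K[OF that]]])
    qed blast
  qed
qed

end
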